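(* Let $\mathcal{M}$ be a simplicial surface in $\mathbb{R}^3$ with set of triangular faces $\mathcal{F}(\mathcal{M})$, and let $f:\mathcal{M}\to\mathbb{R}^2$ be a simplicial mapping such that $f(\tau)$ is a nondegenerate triangle for every $\tau\in\mathcal{F}(\mathcal{M})$. Then the stretch energy of $f$ satisfies $$E_S(f)=\sum_{\tau\in\mathcal{F}(\mathcal{M})}\frac{|f(\tau)|^2}{|\tau|}.$$
   Context: A simplicial surface $\mathcal{M}$ is a finite simplicial 2-complex in $\mathbb{R}^3$ with vertices $v_1,\dots,v_n$ that is the union of its (nondegenerate) triangular faces $\tau=[v_i,v_j,v_k]$, with edge set $\mathcal{E}(\mathcal{M})$ and face set $\mathcal{F}(\mathcal{M})$. $|\cdot|$ applied to a triangle denotes its area. A simplicial mapping $f:\mathcal{M}\to\mathbb{R}^2$ is a map that is affine on each face, hence determined by its vertex images $\mathbf{f}_\ell=f(v_\ell)=(f_\ell^1,f_\ell^2)^\top$; put $\mathbf{f}^s=(f_1^s,\dots,f_n^s)^\top$, $s=1,2$. The stretch energy is $$E_S(f)=\frac12\left((\mathbf{f}^1)^\top L_S(f)\,\mathbf{f}^1+(\mathbf{f}^2)^\top L_S(f)\,\mathbf{f}^2\right),$$ where $L_S(f)$ is the $n\times n$ matrix with $$[L_S(f)]_{i,j}=-\frac12\sum_{[v_i,v_j,v_k]\in\mathcal{F}(\mathcal{M})}\frac{\cot(\theta_{i,j}^k(f))\,|f([v_i,v_j,v_k])|}{|[v_i,v_j,v_k]|}\quad\text{if }i\neq j,\ [v_i,v_j]\in\mathcal{E}(\mathcal{M})$$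 (sum over the faces containing the edge $[v_i,v_j]$), $[L_S(f)]_{i,i}=-\sum_{\ell\ne i}[L_S(f)]_{i,\ell}$, and all other entries $0$. Here $\theta_{i,j}^k(f)\in(0,\pi)$ is the angle at $\mathbf{f}_k$, opposite the edge $[\mathbf{f}_i,\mathbf{f}_j]$, in the image triangle $[\mathbf{f}_i,\mathbf{f}_j,\mathbf{f}_k]$. *)

theory Defs
  imports "HOL-Analysis.Analysis"
begin

section \<open>Two-dimensional area of planar sets\<close>

definition affine_isometry :: "('a::euclidean_space \<Rightarrow> 'b::euclidean_space) \<Rightarrow> bool" where
  "affine_isometry \<phi> \<longleftrightarrow> (\<exists>c g. linear g \<and> (\<forall>x. norm (g x) = norm x) \<and> \<phi> = (\<lambda>x. c + g x))"

text \<open>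
  A triangle in $\mathbb{R}^3$ is a null set for the three-dimensional Lebesgue measure; its area
  is the Lebesgue measure of the set in isometric coordinates of a plane containing it.  For a set
  that is contained in no plane the value is meaningless.  The lemmas \<open>area_eq\<close> and
  \<open>area_eq_measure\<close> below show that the choice of coordinates is irrelevant and that in the plane
  this is the Lebesgue measure itself.
\<close>

definition area :: "'a::euclidean_space set \<Rightarrow> real" where
  "area S = measure lebesgue
     ((SOME \<phi> :: real^2 \<Rightarrow> 'a. affine_isometry \<phi> \<and> S \<subseteq> range \<phi>) -` S)"

lemma affine_isometry_dist: "affine_isometry \<phi> \<Longrightarrow> dist (\<phi> x) (\<phi> y) = dist x y"
  by (auto simp: affine_isometry_def dist_norm linear_diff[symmetric])

lemma affine_isometry_inj: "affine_isometry \<phi> \<Longrightarrow> inj \<phi>"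
  by (metis affine_isometry_dist dist_eq_0_iff injI)

lemma affine_isometry_range:
  fixes \<phi> :: "'a::euclidean_space \<Rightarrow> 'b::euclidean_space"
  assumes "affine_isometry \<phi>"
  shows "affine (range \<phi>)" "aff_dim (range \<phi>) = DIM('a)"
proof -
  obtain c g where g: "linear g" "\<And>x. norm (g x) = norm x" and \<phi>: "\<phi> = (\<lambda>x. c + g x)"
    using assms unfolding affine_isometry_def by blast
  have r: "range \<phi> = (+) c ` range g" unfolding \<phi> by auto
  have "subspace (range g)" using g(1) linear_subspace_image subspace_UNIV by blast
  then show "affine (range \<phi>)" unfolding r using affine_translation subspace_imp_affine by blast
  have "inj g" using g by (metis linear_injective_0 norm_eq_zero)
  then show "aff_dim (range \<phi>) = DIM('a)"
    unfolding r using g(1) by (simp add: aff_dim_translation_eq aff_dim_injective_linear_image)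
qed

lemma measure_isometry_image:
  fixes \<rho> :: "real^2 \<Rightarrow> real^2"
  assumes "\<And>x y. dist (\<rho> x) (\<rho> y) = dist x y" and "S \<in> lmeasurable"
  shows "measure lebesgue (\<rho> ` S) = measure lebesgue S"
proof -
  define g where "g = (\<lambda>x. \<rho> x - \<rho> 0)"
  have g: "orthogonal_transformation g"
    unfolding orthogonal_transformation_isometry g_def using assms(1) by (auto simp: dist_norm)
  have "\<rho> ` S = (+) (\<rho> 0) ` (g ` S)" unfolding g_def by (auto simp: image_image)
  then show ?thesis using measure_orthogonal_image[OF g assms(2)] by (simp add: measure_translation)
qed

lemma area_eq:
  fixes S :: "'a::euclidean_space set" and \<phi> :: "real^2 \<Rightarrow> 'a"
  assumes \<phi>: "affine_isometry \<phi>" "S \<subseteq> range \<phi>" and dim: "aff_dim S = 2"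
    and meas: "\<phi> -` S \<in> lmeasurable"
  shows "area S = measure lebesgue (\<phi> -` S)"
proof -
  define \<psi> :: "real^2 \<Rightarrow> 'a" where "\<psi> = (SOME \<phi>. affine_isometry \<phi> \<and> S \<subseteq> range \<phi>)"
  have \<psi>: "affine_isometry \<psi>" "S \<subseteq> range \<psi>"
    using someI[of "\<lambda>\<phi>::real^2 \<Rightarrow> 'a. affine_isometry \<phi> \<and> S \<subseteq> range \<phi>" \<phi>] \<phi>
    unfolding \<psi>_def by auto
  have hull: "affine hull S = range h" if "affine_isometry h" "S \<subseteq> range h" for h :: "real^2 \<Rightarrow> 'a"
  proof (rule affine_dim_equal)
    show "affine hull S \<noteq> {}" using dim by auto
    show "affine hull S \<subseteq> range h" using that affine_isometry_range(1) hull_minimal by metis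
    show "aff_dim (affine hull S) = aff_dim (range h)" using that dim affine_isometry_range(2) by force
  qed (use that affine_isometry_range in auto)
  have r: "range \<phi> = range \<psi>" using hull[OF \<phi>] hull[OF \<psi>] by simp
  define \<rho> where "\<rho> = inv \<psi> \<circ> \<phi>"
  have \<rho>: "\<psi> (\<rho> x) = \<phi> x" for x
    unfolding \<rho>_def using r by (metis comp_apply f_inv_into_f rangeI)
  have "dist (\<rho> x) (\<rho> y) = dist x y" for x y
    using \<rho> affine_isometry_dist \<phi>(1) \<psi>(1) by metis
  then have "measure lebesgue (\<rho> ` (\<phi> -` S)) = measure lebesgue (\<phi> -` S)"
    using meas by (rule measure_isometry_image)
  moreover have "\<rho> ` (\<phi> -` S) = \<psi> -` S"
  proof (intro equalityI subsetI)
    fix y assume "y \<in> \<psi> -` S"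
    then obtain x where "\<psi> y = \<phi> x" using r by (metis rangeE rangeI)
    then have "y = \<rho> x" using \<rho> affine_isometry_inj[OF \<psi>(1)] by (metis injD)
    then show "y \<in> \<rho> ` (\<phi> -` S)" using \<open>y \<in> \<psi> -` S\<close> \<rho> by auto
  qed (use \<rho> in auto)
  ultimately show ?thesis unfolding area_def \<psi>_def[symmetric] by simp
qed

lemma area_eq_measure:
  fixes S :: "(real^2) set"
  assumes "S \<in> lmeasurable" "aff_dim S = 2"
  shows "area S = measure lebesgue S"
proof -
  have "affine_isometry (id :: real^2 \<Rightarrow> real^2)"
    unfolding affine_isometry_def by (intro exI[of _ 0] exI[of _ id]) (auto simp: linear_id)
  then show ?thesis using area_eq[of id S] assms by simp
qed


section \<open>Simplicial surfaces and simplicial mappings\<close>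

definition vertices :: "'a::euclidean_space set set \<Rightarrow> 'a set" where
  "vertices \<M> = {x. {x} \<in> \<M>}"

definition edges :: "'a::euclidean_space set set \<Rightarrow> 'a set set" where
  "edges \<M> = {e \<in> \<M>. 1 simplex e}"

definition faces :: "'a::euclidean_space set set \<Rightarrow> 'a set set" where
  "faces \<M> = {\<tau> \<in> \<M>. 2 simplex \<tau>}"

definition simplicial_surface :: "(real^3) set set \<Rightarrow> bool" where
  "simplicial_surface \<M> \<longleftrightarrow>
     simplicial_complex \<M> \<and> (\<forall>\<sigma>\<in>\<M>. \<exists>\<tau>\<in>faces \<M>. \<sigma> face_of \<tau>)"

text \<open>Only the values of the map on the union of the faces matter.\<close>

definition simplicial_mapping :: "(real^3) set set \<Rightarrow> (real^3 \<Rightarrow> real^2) \<Rightarrow> bool" where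
  "simplicial_mapping \<M> f \<longleftrightarrow>
     (\<forall>\<tau>\<in>faces \<M>. \<exists>g c. linear g \<and> (\<forall>x\<in>\<tau>. f x = g x + c))"


section \<open>The stretch energy\<close>

definition angle_at :: "real^2 \<Rightarrow> real^2 \<Rightarrow> real^2 \<Rightarrow> real" where
  "angle_at c a b = arccos (((a - c) \<bullet> (b - c)) / (norm (a - c) * norm (b - c)))"

text \<open>
  The vertices of the surface are enumerated by a finite type, via \<open>v\<close>.  A face containing a given
  edge is determined by its third vertex, so the sum over these faces is a sum over indices \<open>k\<close>;
  degenerate choices of \<open>k\<close> do not contribute, since then the hull is not a 2-simplex.
\<close>

definition stretch_offdiag ::
    "(real^3) set set \<Rightarrow> ('n::finite \<Rightarrow> real^3) \<Rightarrow> (real^3 \<Rightarrow> real^2) \<Rightarrow> 'n \<Rightarrow> 'n \<Rightarrow> real" where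
  "stretch_offdiag \<M> v f i j =
     (if convex hull {v i, v j} \<in> edges \<M>
      then - (1 / 2) * (\<Sum>k | convex hull {v i, v j, v k} \<in> faces \<M>.
             cot (angle_at (f (v k)) (f (v i)) (f (v j)))
               * area (f ` (convex hull {v i, v j, v k})) / area (convex hull {v i, v j, v k}))
      else 0)"

definition stretch_laplacian ::
    "(real^3) set set \<Rightarrow> ('n::finite \<Rightarrow> real^3) \<Rightarrow> (real^3 \<Rightarrow> real^2) \<Rightarrow> real^'n^'n" where
  "stretch_laplacian \<M> v f =
     (\<chi> i j. if i = j then - (\<Sum>l\<in>UNIV - {i}. stretch_offdiag \<M> v f i l)
            else stretch_offdiag \<M> v f i j)"

definition coord_vec ::
    "('n::finite \<Rightarrow> real^3) \<Rightarrow> (real^3 \<Rightarrow> real^2) \<Rightarrow> 2 \<Rightarrow> real^'n" where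
  "coord_vec v f s = (\<chi> l. f (v l) $ s)"

definition stretch_energy ::
    "(real^3) set set \<Rightarrow> ('n::finite \<Rightarrow> real^3) \<Rightarrow> (real^3 \<Rightarrow> real^2) \<Rightarrow> real" where
  "stretch_energy \<M> v f =
     1 / 2 * (coord_vec v f 1 \<bullet> (stretch_laplacian \<M> v f *v coord_vec v f 1)
            + coord_vec v f 2 \<bullet> (stretch_laplacian \<M> v f *v coord_vec v f 2))"

end

theory Submission
  imports Defs
begin

text \<open>
  Expanding the quadratic form of the Laplacian without using its symmetry turns the energy into a
  sum over the ordered triples of vertices that span a face, and exactly the six orderings of its
  vertices span a given face.  For a nondegenerate planar triangle with apex \<open>c\<close>, the cotangent
  weight times the area is \<open>(a - c) \<bullet> (b - c) / 2\<close>, since the sine of the angle and the area are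
  given by the same determinant.  So the contribution of a face, multiplied by its area, is a
  polynomial in the coordinates of the image vertices; summed over the six orderings it is the
  square of that determinant.
\<close>

section \<open>Planar triangles\<close>

lemma area_triangle:
  fixes a b c :: "real^2"
  assumes "aff_dim {a, b, c} = 2"
  shows "area (convex hull {a, b, c}) =
           \<bar>(a $ 1 - c $ 1) * (b $ 2 - c $ 2) - (a $ 2 - c $ 2) * (b $ 1 - c $ 1)\<bar> / 2"
proof -
  have c: "compact (convex hull {a, b, c})"
    by (simp add: finite_imp_compact_convex_hull)
  \<comment> \<open>\<open>content_triangle\<close> takes differences from the first listed point;
    the reversed order makes \<open>c\<close> the base point.\<close>
  have "{c, b, a} = {a, b, c}" by auto
  with c have "area (convex hull {a, b, c}) = measure lborel (convex hull {c, b, a})"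
    using assms by (subst area_eq_measure)
      (auto simp: lmeasurable_compact aff_dim_convex_hull compact_imp_closed)
  then show ?thesis unfolding content_triangle by (simp add: mult.commute)
qed

lemma cot_arccos:
  assumes "\<bar>x\<bar> \<le> 1"
  shows "cot (arccos x) = x / sqrt (1 - x\<^sup>2)"
  using assms by (simp add: cot_def sin_arccos_abs)

lemma cot_angle_at_mult_area:
  fixes a b c :: "real^2"
  assumes "aff_dim {a, b, c} = 2"
  shows "cot (angle_at c a b) * area (convex hull {a, b, c}) = (a - c) \<bullet> (b - c) / 2"
proof -
  define u w where "u = a - c" and "w = b - c"
  define d where "d = u $ 1 * w $ 2 - u $ 2 * w $ 1"
  have lagrange: "(norm u * norm w)\<^sup>2 - (u \<bullet> w)\<^sup>2 = d\<^sup>2"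
    unfolding power_mult_distrib power2_norm_eq_inner inner_vec_def sum_2 d_def
    by (simp add: power2_eq_square algebra_simps)
  \<comment> \<open>Nondegeneracy makes Cauchy-Schwarz strict for \<open>u\<close> and
    \<open>w\<close>; by \<open>lagrange\<close> this gives a nonzero determinant
    \<open>d\<close>.\<close>
  have "\<not> collinear {a, c, b}"
    using assms by (simp add: collinear_aff_dim insert_commute)
  then have "\<not> collinear {0, u, w}"
    unfolding u_def w_def by (subst (asm) collinear_3) auto
  then have ne: "\<bar>u \<bullet> w\<bar> \<noteq> norm u * norm w" "u \<noteq> 0" "w \<noteq> 0"
    unfolding norm_cauchy_schwarz_equal by (auto simp: insert_commute)
  define n where "n = norm u * norm w"
  have n: "n > 0" using ne by (simp add: n_def)
  have "d \<noteq> 0"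
  proof
    assume "d = 0"
    then have "n\<^sup>2 = \<bar>u \<bullet> w\<bar>\<^sup>2" using lagrange by (simp add: n_def)
    then show False using ne n unfolding n_def[symmetric]
      by (metis abs_ge_zero less_imp_le power2_eq_imp_eq)
  qed
  \<comment> \<open>This is the squared sine of the angle, so the sine is
    \<open>\<bar>d\<bar> / n\<close> and \<open>n\<close> cancels from the cotangent.\<close>
  have "1 - ((u \<bullet> w) / n)\<^sup>2 = (n\<^sup>2 - (u \<bullet> w)\<^sup>2) / n\<^sup>2"
    using n by (simp add: power_divide diff_divide_distrib)
  also have "\<dots> = (d / n)\<^sup>2"
    using lagrange by (simp add: n_def power_divide)
  finally have s: "sqrt (1 - ((u \<bullet> w) / n)\<^sup>2) = \<bar>d\<bar> / n"
    using n by simp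
  have "\<bar>(u \<bullet> w) / n\<bar> \<le> 1"
    using n Cauchy_Schwarz_ineq2[of u w] by (simp add: n_def)
  then have "cot (angle_at c a b) = ((u \<bullet> w) / n) / (\<bar>d\<bar> / n)"
    unfolding angle_at_def using cot_arccos s
    by (simp add: u_def w_def n_def)
  then have cot_eq: "cot (angle_at c a b) = (u \<bullet> w) / \<bar>d\<bar>" using n by simp
  have half_det: "area (convex hull {a, b, c}) = \<bar>d\<bar> / 2"
    using area_triangle[OF assms] by (simp add: d_def u_def w_def)
  show ?thesis
    unfolding cot_eq half_det u_def[symmetric] w_def[symmetric] using \<open>d \<noteq> 0\<close> by simp
qed

text \<open>Exchanging the first two arguments pairs the terms into
  \<open>(a - c) \<bullet> (b - c) / 2\<close> times the squared length of the side from
  \<open>a\<close> to \<open>b\<close>. By the law of cosines the three pairs add up to a quarter of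
  the polynomial in the squared sides that Heron's formula equates with 16 times the squared
  area.\<close>

lemma sum_orderings_eq_area_squared:
  fixes a b c :: "real^2"
  assumes "aff_dim {a, b, c} = 2"
    and F: "\<And>x y z. F x y z = (x - z) \<bullet> (y - z) / 2 * (x \<bullet> (x - y))"
  shows "F a b c + F b a c + F b c a + F c b a + F c a b + F a c b
           = 4 * (area (convex hull {a, b, c}))\<^sup>2"
  unfolding area_triangle[OF assms(1)] F inner_vec_def sum_2
  by (simp add: power_divide power2_eq_square field_simps)

section \<open>Triangles in a simplicial surface\<close>

text \<open>Dimension 2 forces three distinct points, so index triples with a repetition never span
  a face.\<close>

lemma triangle_2_simplexD:
  assumes "2 simplex (convex hull {a, b, c})"
  shows "\<not> affine_dependent {a, b, c}" "a \<noteq> b" "b \<noteq> c" "a \<noteq> c" "aff_dim {a, b, c} = 2"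
proof -
  show d: "aff_dim {a, b, c} = 2"
    using aff_dim_simplex[OF assms] by (simp add: aff_dim_convex_hull)
  then have "card {a, b, c} \<ge> 3"
    using aff_dim_le_card[of "{a, b, c}"] by simp
  moreover have "card {a, b, c} \<le> 3"
    by (simp add: card_insert_if)
  ultimately have c: "card {a, b, c} = 3" by simp
  then show "\<not> affine_dependent {a, b, c}"
    using d by (simp add: affine_independent_iff_card)
  show "a \<noteq> b" "b \<noteq> c" "a \<noteq> c" using c by (auto simp: card_insert_if split: if_splits)
qed

text \<open>An affinely independent set is recovered from its hull as the set of extreme
  points.\<close>

lemma convex_hull_affine_independent_eq_iff:
  fixes S T :: "'a::euclidean_space set"
  assumes "\<not> affine_dependent S" "\<not> affine_dependent T"
  shows "convex hull S = convex hull T \<longleftrightarrow> S = T"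
proof
  assume h: "convex hull S = convex hull T"
  have "x \<in> S \<longleftrightarrow> x \<in> T" for x
    using extreme_point_of_convex_hull_affine_independent[OF assms(1), of x]
      extreme_point_of_convex_hull_affine_independent[OF assms(2), of x]
    by (simp add: h)
  then show "S = T" by blast
qed simp

lemma edge_of_face:
  assumes "simplicial_surface \<M>" "convex hull {a, b, c} \<in> faces \<M>"
  shows "convex hull {a, b} \<in> edges \<M>"
proof -
  have s: "convex hull {a, b, c} \<in> \<M>" "2 simplex (convex hull {a, b, c})"
    using assms(2) by (auto simp: faces_def)
  note t = triangle_2_simplexD[OF s(2)]
  have "convex hull {a, b} face_of convex hull {a, b, c}"
    using face_of_convex_hull_affine_independent[OF t(1)] insert_mono[OF insert_mono[OF empty_subsetI]]
    by metis
  then have "convex hull {a, b} \<in> \<M>"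
    using assms(1) s(1) unfolding simplicial_surface_def simplicial_complex_def by blast
  moreover have "1 simplex (convex hull {a, b})"
    using one_simplex_segment[OF t(2)] by (simp add: segment_convex_hull)
  ultimately show ?thesis by (simp add: edges_def)
qed

text \<open>Each corner of a face is itself a singleton face of it, hence lies in the complex and is
  a value of \<open>v\<close>.\<close>

lemma face_eq_convex_hull_vertices:
  fixes v :: "'n \<Rightarrow> real^3"
  assumes "simplicial_surface \<M>" "range v = vertices \<M>" "\<tau> \<in> faces \<M>"
  obtains i j k where "\<tau> = convex hull {v i, v j, v k}"
proof -
  have \<tau>: "\<tau> \<in> \<M>" "2 simplex \<tau>" using assms(3) by (auto simp: faces_def)
  then obtain C where C: "\<not> affine_dependent C" "card C = 3" "\<tau> = convex hull C"
    unfolding simplex_def by auto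
  have "x \<in> range v" if "x \<in> C" for x
  proof -
    have "{x} face_of \<tau>"
      using that C extreme_point_of_convex_hull_affine_independent face_of_singleton by blast
    then have "{x} \<in> \<M>"
      using assms(1) \<tau>(1) unfolding simplicial_surface_def simplicial_complex_def by blast
    then show ?thesis by (simp add: assms(2) vertices_def)
  qed
  moreover obtain x y z where xyz: "C = {x, y, z}"
    using C(2) by (metis card_3_iff)
  ultimately have "x \<in> range v" "y \<in> range v" "z \<in> range v" by auto
  then obtain i j k where "x = v i" "y = v j" "z = v k"
    by auto
  then show thesis using that[of i j k] C(3) xyz by simp
qed

lemma simplicial_mapping_image_convex_hull:
  assumes "simplicial_mapping \<M> f" "convex hull S \<in> faces \<M>"
  shows "f ` (convex hull S) = convex hull (f ` S)"
proof -
  obtain g c where g: "linear g" "\<And>x. x \<in> convex hull S \<Longrightarrow> f x = g x + c"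
    using assms unfolding simplicial_mapping_def by blast
  \<comment> \<open>\<open>f\<close> is known to be affine only on this hull, so it is replaced by
    \<open>g\<close> plus a constant on subsets of the hull, among them \<open>S\<close>
    itself.\<close>
  have im: "f ` T = (+) c ` g ` T" if "T \<subseteq> convex hull S" for T
    unfolding image_image using that g(2) by (intro image_cong) auto
  show ?thesis
    unfolding im[OF order_refl] im[OF hull_subset] convex_hull_translation
      convex_hull_linear_image[OF g(1)] ..
qed

section \<open>The stretch energy as a sum over faces\<close>

text \<open>The rows sum to zero, so each row acts on \<open>x\<close> through differences; the term
  \<open>j = i\<close> vanishes, whatever the value of \<open>w i i\<close>.\<close>

lemma laplacian_quadratic_form:
  fixes x :: "real^'n" and w :: "'n \<Rightarrow> 'n \<Rightarrow> real"
  shows "x \<bullet> ((\<chi> i j. if i = j then - (\<Sum>l\<in>UNIV - {i}. w i l) else w i j) *v x)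
           = - (\<Sum>i\<in>UNIV. \<Sum>j\<in>UNIV. w i j * (x $ i * (x $ i - x $ j)))"
proof -
  have "x $ i * (\<Sum>j\<in>UNIV. (if i = j then - (\<Sum>l\<in>UNIV - {i}. w i l) else w i j) * x $ j)
          = - (\<Sum>j\<in>UNIV. w i j * (x $ i * (x $ i - x $ j)))" for i
    by (simp add: sum.remove[of UNIV i] sum_distrib_left sum_distrib_right algebra_simps
        sum_subtractf sum_negf)
  then show ?thesis
    by (simp add: inner_vec_def matrix_vector_mult_def sum_negf)
qed

text \<open>Cotangent and image area merge into an inner product, leaving only the area of the
  original face in the denominator.\<close>

lemma stretch_offdiag_eq:
  fixes v :: "'n::finite \<Rightarrow> real^3"
  assumes "simplicial_surface \<M>" "simplicial_mapping \<M> f"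
    and "\<forall>\<tau>\<in>faces \<M>. 2 simplex (f ` \<tau>)"
  shows "stretch_offdiag \<M> v f i j = - (1 / 2) *
    (\<Sum>k | convex hull {v i, v j, v k} \<in> faces \<M>.
       (f (v i) - f (v k)) \<bullet> (f (v j) - f (v k)) / 2 / area (convex hull {v i, v j, v k}))"
proof (cases "convex hull {v i, v j} \<in> edges \<M>")
  case True
  have weight: "cot (angle_at (f (v k)) (f (v i)) (f (v j))) * area (f ` (convex hull {v i, v j, v k}))
          = (f (v i) - f (v k)) \<bullet> (f (v j) - f (v k)) / 2"
    if k: "convex hull {v i, v j, v k} \<in> faces \<M>" for k
  proof -
    have im: "f ` (convex hull {v i, v j, v k}) = convex hull {f (v i), f (v j), f (v k)}"
      using simplicial_mapping_image_convex_hull[OF assms(2) k] by simp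
    show ?thesis
      using bspec[OF assms(3) k] unfolding im by (intro cot_angle_at_mult_area triangle_2_simplexD)
  qed
  show ?thesis
    unfolding stretch_offdiag_def if_P[OF True]
    by (intro arg_cong[of _ _ "(*) (- (1 / 2))"] sum.cong refl) (simp only: weight mem_Collect_eq)
next
  case False
  \<comment> \<open>A pair that spans no edge lies in no face, so the default value 0 agrees with
    the empty sum.\<close>
  then have "{k. convex hull {v i, v j, v k} \<in> faces \<M>} = {}"
    using edge_of_face[OF assms(1)] by blast
  then show ?thesis using False by (simp add: stretch_offdiag_def)
qed

text \<open>The two coordinates combine into inner products in the plane. The factor 1/4 comes from
  the 1/2 of the energy and the 1/2 of the weights, and their minus signs cancel.\<close>

lemma stretch_energy_eq_sum_triples:
  fixes v :: "'n::finite \<Rightarrow> real^3"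
  assumes "simplicial_surface \<M>" "simplicial_mapping \<M> f"
    and "\<forall>\<tau>\<in>faces \<M>. 2 simplex (f ` \<tau>)"
  shows "stretch_energy \<M> v f = 1 / 4 *
    (\<Sum>(i, j, k) | convex hull {v i, v j, v k} \<in> faces \<M>.
       (f (v i) - f (v k)) \<bullet> (f (v j) - f (v k)) / 2 * (f (v i) \<bullet> (f (v i) - f (v j)))
         / area (convex hull {v i, v j, v k}))"
    (is "_ = 1 / 4 * (\<Sum>(i, j, k) | ?P i j k. ?G i j k)")
proof -
  have "stretch_energy \<M> v f
      = - (1 / 2) * (\<Sum>i\<in>UNIV. \<Sum>j\<in>UNIV. stretch_offdiag \<M> v f i j * (f (v i) \<bullet> (f (v i) - f (v j))))"
    unfolding stretch_energy_def stretch_laplacian_def laplacian_quadratic_form coord_vec_def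
    by (simp add: inner_vec_def sum_2 ring_distribs sum.distrib)
  also have "\<dots> = 1 / 4 * (\<Sum>i\<in>UNIV. \<Sum>j\<in>UNIV. \<Sum>k | ?P i j k. ?G i j k)"
    unfolding stretch_offdiag_eq[OF assms]
    by (simp add: sum_distrib_left sum_distrib_right sum_negf)
  also have "(\<Sum>i\<in>UNIV. \<Sum>j\<in>UNIV. \<Sum>k | ?P i j k. ?G i j k)
      = (\<Sum>(i, j, k) \<in> (SIGMA i:UNIV. SIGMA j:UNIV. {k. ?P i j k}). ?G i j k)"
    by (simp add: sum.Sigma)
  also have "(SIGMA i:UNIV. SIGMA j:UNIV. {k. ?P i j k}) = {(i, j, k). ?P i j k}"
    by auto
  finally show ?thesis .
qed

text \<open>Equal hulls have equal corner sets, which injectivity of \<open>v\<close> pulls back to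
  equal index sets; as \<open>i\<close>, \<open>j\<close>, \<open>k\<close> are distinct, only their
  permutations remain.\<close>

lemma triples_spanning_triangle:
  fixes v :: "'n \<Rightarrow> 'a::euclidean_space"
  assumes "inj v" and s: "2 simplex (convex hull {v i, v j, v k})"
  shows "{(p, q, r). convex hull {v p, v q, v r} = convex hull {v i, v j, v k}}
           = {(i, j, k), (j, i, k), (j, k, i), (k, j, i), (k, i, j), (i, k, j)}"
proof -
  note t = triangle_2_simplexD[OF s]
  have "convex hull {v p, v q, v r} = convex hull {v i, v j, v k} \<longleftrightarrow> {p, q, r} = {i, j, k}" for p q r
  proof
    assume h: "convex hull {v p, v q, v r} = convex hull {v i, v j, v k}"
    then have "\<not> affine_dependent {v p, v q, v r}"
      using s by (metis triangle_2_simplexD(1))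
    then have "v ` {p, q, r} = v ` {i, j, k}"
      using h convex_hull_affine_independent_eq_iff[OF _ t(1)] by simp
    then show "{p, q, r} = {i, j, k}"
      unfolding inj_image_eq_iff[OF assms(1)] .
  next
    assume "{p, q, r} = {i, j, k}"
    then have "v ` {p, q, r} = v ` {i, j, k}" by (rule arg_cong)
    then show "convex hull {v p, v q, v r} = convex hull {v i, v j, v k}" by simp
  qed
  moreover have "{p, q, r} = {i, j, k} \<longleftrightarrow>
      (p, q, r) \<in> {(i, j, k), (j, i, k), (j, k, i), (k, j, i), (k, i, j), (i, k, j)}"
    (is "_ \<longleftrightarrow> ?perm") for p q r
  proof
    assume "{p, q, r} = {i, j, k}"
    then have "p \<in> {i, j, k}" "q \<in> {i, j, k}" "r \<in> {i, j, k}"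
      "i \<in> {p, q, r}" "j \<in> {p, q, r}" "k \<in> {p, q, r}"
      by blast+
    moreover have "i \<noteq> j" "j \<noteq> k" "i \<noteq> k" using t(2-4) by auto
    ultimately show ?perm
      unfolding insert_iff empty_iff prod.inject by metis
  qed (auto simp: insert_commute)
  ultimately show ?thesis by auto
qed

theorem theorem2:
  fixes \<M> :: "(real^3) set set"
    and v :: "'n::finite \<Rightarrow> real^3"
    and f :: "real^3 \<Rightarrow> real^2"
  assumes "simplicial_surface \<M>"
    and "bij_betw v UNIV (vertices \<M>)"
    and "simplicial_mapping \<M> f"
    and "\<And>\<tau>. \<tau> \<in> faces \<M> \<Longrightarrow> 2 simplex (f ` \<tau>)"
  shows "stretch_energy \<M> v f = (\<Sum>\<tau>\<in>faces \<M>. (area (f ` \<tau>))\<^sup>2 / area \<tau>)"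
proof -
  define tri where "tri = (\<lambda>(i, j, k). convex hull {v i, v j, v k})"
  define F :: "real^2 \<Rightarrow> real^2 \<Rightarrow> real^2 \<Rightarrow> real"
    where "F = (\<lambda>a b c. (a - c) \<bullet> (b - c) / 2 * (a \<bullet> (a - b)))"
  define G where "G = (\<lambda>(i, j, k). F (f (v i)) (f (v j)) (f (v k)) / area (tri (i, j, k)))"
  have v: "inj v" "range v = vertices \<M>"
    using assms(2) by (auto simp: bij_betw_def)
  have nondeg: "\<forall>\<tau>\<in>faces \<M>. 2 simplex (f ` \<tau>)"
    using assms(4) by blast
  have fin: "finite (faces \<M>)"
    using assms(1) by (simp add: simplicial_surface_def simplicial_complex_def faces_def)
  have face: "(\<Sum>t | tri t = \<tau>. G t) = 4 * ((area (f ` \<tau>))\<^sup>2 / area \<tau>)" if \<tau>: "\<tau> \<in> faces \<M>" for \<tau>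
  proof -
    obtain i j k where ijk: "\<tau> = convex hull {v i, v j, v k}"
      using face_eq_convex_hull_vertices[OF assms(1) v(2) \<tau>] by metis
    have s: "2 simplex (convex hull {v i, v j, v k})"
      using \<tau> by (simp add: ijk faces_def)
    have ne: "i \<noteq> j" "j \<noteq> k" "i \<noteq> k" using triangle_2_simplexD(2-4)[OF s] by auto
    have im: "f ` \<tau> = convex hull {f (v i), f (v j), f (v k)}"
      using simplicial_mapping_image_convex_hull[OF assms(3)] \<tau> by (simp add: ijk)
    have d: "aff_dim {f (v i), f (v j), f (v k)} = 2"
      using assms(4)[OF \<tau>] unfolding im by (rule triangle_2_simplexD)
    have "{t. tri t = \<tau>} = {(p, q, r). convex hull {v p, v q, v r} = convex hull {v i, v j, v k}}"
      by (auto simp: tri_def ijk)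
    also note triples_spanning_triangle[OF v(1) s]
    finally have T: "{t. tri t = \<tau>} =
        {(i, j, k), (j, i, k), (j, k, i), (k, j, i), (k, i, j), (i, k, j)}" .
    \<comment> \<open>The denominator is the same for all triples spanning \<open>\<tau>\<close>, so
      only the polynomial \<open>F\<close> remains to be summed.\<close>
    have "(\<Sum>t | tri t = \<tau>. G t)
        = (\<Sum>(p, q, r) \<in> {t. tri t = \<tau>}. F (f (v p)) (f (v q)) (f (v r))) / area \<tau>"
      by (auto simp: sum_divide_distrib G_def intro!: sum.cong)
    also have "(\<Sum>(p, q, r) \<in> {t. tri t = \<tau>}. F (f (v p)) (f (v q)) (f (v r)))
        = 4 * (area (f ` \<tau>))\<^sup>2"
      \<comment> \<open>By \<open>ne\<close> the six listed triples are pairwise distinct, so the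
        sum over the set has six terms.\<close>
      using ne sum_orderings_eq_area_squared[OF d, of F] unfolding T im
      by (simp add: F_def)
    finally show ?thesis by simp
  qed
  have "stretch_energy \<M> v f = 1 / 4 * (\<Sum>t | tri t \<in> faces \<M>. G t)"
    unfolding stretch_energy_eq_sum_triples[OF assms(1,3) nondeg]
    by (intro arg_cong[of _ _ "(*) (1/4)"] sum.cong) (auto simp: tri_def G_def F_def)
  \<comment> \<open>Triples are grouped by the face they span; each group yields a factor 4, which
    cancels the 1/4.\<close>
  also have "(\<Sum>t | tri t \<in> faces \<M>. G t)
      = (\<Sum>\<tau>\<in>faces \<M>. \<Sum>t | t \<in> {t. tri t \<in> faces \<M>} \<and> tri t = \<tau>. G t)"
    by (rule sum.group[symmetric]) (auto simp: fin)
  also have "\<dots> = (\<Sum>\<tau>\<in>faces \<M>. 4 * ((area (f ` \<tau>))\<^sup>2 / area \<tau>))"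
  proof (rule sum.cong)
    fix \<tau> assume \<tau>: "\<tau> \<in> faces \<M>"
    then have "{t. t \<in> {t. tri t \<in> faces \<M>} \<and> tri t = \<tau>} = {t. tri t = \<tau>}" by auto
    then show "(\<Sum>t | t \<in> {t. tri t \<in> faces \<M>} \<and> tri t = \<tau>. G t)
        = 4 * ((area (f ` \<tau>))\<^sup>2 / area \<tau>)"
      using face[OF \<tau>] by simp
  qed simp
  finally show ?thesis unfolding sum_distrib_left[symmetric] by simp
qed

end
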